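(* Let $X=\Gamma$ be a finitely generated group with the word length metric $d_X$, and suppose that $\Gamma$ has property (I). Then the inverse semigroup $M(X)$ is not weakly finite.
   Context: Property (I): the word length metric is the left-invariant metric $d_X(x,y)=|x^{-1}y|$ with respect to a finite generating set, and for $x\in X$, $Y\subset X$, $d_X(x,Y)=\inf_{y\in Y}d_X(x,y)$. The group $\Gamma$ has property (I) if there are subsets $Y,Z\subset X$ such that: (i1) $X=Y\sqcup Z$, and for any $D>0$ there exists $z\in Z$ such that $d_X(z,Y)>D$; (i2) there exist $g,h\in\Gamma$ such that $gY\subset Y$, $hZ\subset Y$ and $gY\cap hZ=\emptyset$; (i3) for these $g,h$ there exists $C>0$ such that $|d_X(gy,hz)-d_X(y,z)|<C$ for any $y\in Y$, $z\in Z$. The inverse semigroup $M(X)$ of a metric space $(X,d_X)$: the double of $X$ is $X\sqcup X'$, where $X=X\times\{0\}$ and $X'=X\times\{1\}$ are two copies of $X$; write $x=(x,0)$ and $x'=(x,1)$. Let $\mathcal M(X)$ be the set of all metrics $d$ on $X\sqcup X'$ whose restriction to each of the two copies of $X$ is $d_X$ and which satisfy $\inf_{x,y\in X}d(x,y')>0$. Two metrics $b,d$ on a set $Z$ are coarsely equivalent if there are monotone functions $\varphi,\psi:[0,\infty)\to[0,\infty)$ with $\lim_{t\to\infty}\varphi(t)=\lim_{t\to\infty}\psi(t)=\infty$ such that $\varphi(d(z_1,z_2))\le b(z_1,z_2)\le\psi(d(z_1,z_2))$ for all $z_1,z_2\in Z$; $[d]$ denotes the coarse equivalence class of $d$. $M(X)$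 is the set of coarse equivalence classes of metrics in $\mathcal M(X)$, with multiplication $[\rho][d]=[\rho\circ d]$, where $\rho\circ d\in\mathcal M(X)$ is determined by $(\rho\circ d)(x,z')=\inf_{y\in X}[d(x,y')+\rho(y,z')]$ for $x,z\in X$. It is known that this is well defined and that $M(X)$ is an inverse semigroup; the pseudo-inverse of $s=[d]$ is $s^*=[d^*]$ with $d^*(x,y')=d(x',y)$, and the unit $\mathbf 1$ is the class of the metric $d(x,y')=d_X(x,y)+1$. Finiteness: let $S$ be an inverse semigroup with set of idempotents $E(S)$, partially ordered by $f\le e$ iff $f=fe$. Idempotents $e,f$ are equivalent, $e\sim f$, if there is $s\in S$ with $s^*s=e$ and $ss^*=f$. An idempotent $e$ is infinite if there is $f\in E(S)$ with $f\le e$, $f\ne e$ and $f\sim e$; otherwise $e$ is finite. $S$ is weakly finite if it is unital and its unit is a finite idempotent. *)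

theory Defs
  imports "HOL-Algebra.Generated_Groups" "HOL-Analysis.Abstract_Metric_Spaces"
begin

section \<open>Word metrics and property (I)\<close>

definition word_length :: "('a, 'b) monoid_scheme \<Rightarrow> 'a set \<Rightarrow> 'a \<Rightarrow> nat" where
  "word_length G S x =
     (LEAST n. \<exists>ws. length ws = n \<and> set ws \<subseteq> S \<union> m_inv G ` S \<and>
        foldr (mult G) ws \<one>\<^bsub>G\<^esub> = x)"

definition word_dist :: "('a, 'b) monoid_scheme \<Rightarrow> 'a set \<Rightarrow> 'a \<Rightarrow> 'a \<Rightarrow> real" where
  "word_dist G S x y = real (word_length G S (inv\<^bsub>G\<^esub> x \<otimes>\<^bsub>G\<^esub> y))"

text \<open>
  If \<open>Y\<close> were empty, then \<open>Z\<close> would be the whole group and its translate by \<open>h\<close> could not lie in \<open>Y\<close>;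
  so the value of the infimum over the empty set does not matter.
\<close>

definition property_I :: "('a, 'b) monoid_scheme \<Rightarrow> ('a \<Rightarrow> 'a \<Rightarrow> real) \<Rightarrow> bool" where
  "property_I G dX \<longleftrightarrow>
     (\<exists>Y Z. carrier G = Y \<union> Z \<and> Y \<inter> Z = {} \<and>
        (\<forall>D>0. \<exists>z\<in>Z. (INF y\<in>Y. dX z y) > D) \<and>
        (\<exists>g\<in>carrier G. \<exists>h\<in>carrier G.
           g <#\<^bsub>G\<^esub> Y \<subseteq> Y \<and> h <#\<^bsub>G\<^esub> Z \<subseteq> Y \<and>
           (g <#\<^bsub>G\<^esub> Y) \<inter> (h <#\<^bsub>G\<^esub> Z) = {} \<and>
           (\<exists>C>0. \<forall>y\<in>Y. \<forall>z\<in>Z.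
              \<bar>dX (g \<otimes>\<^bsub>G\<^esub> y) (h \<otimes>\<^bsub>G\<^esub> z) - dX y z\<bar> < C)))"


section \<open>The inverse semigroup of a metric space\<close>

text \<open>
  The double of \<open>X\<close> is \<open>X <+> X\<close>, with \<open>Inl x\<close> for \<open>x\<close> and \<open>Inr x\<close> for \<open>x'\<close>.
  Functions in \<open>double_metrics X dX\<close> are unconstrained off the double, except for the global
  symmetry and nonnegativity demanded by \<^locale>\<open>Metric_space\<close>; coarse equivalence below only sees
  their values on the double.
\<close>

definition double_metrics :: "'a set \<Rightarrow> ('a \<Rightarrow> 'a \<Rightarrow> real) \<Rightarrow> ('a + 'a \<Rightarrow> 'a + 'a \<Rightarrow> real) set" where
  "double_metrics X dX =
     {d. Metric_space (X <+> X) d \<and>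
         (\<forall>x\<in>X. \<forall>y\<in>X. d (Inl x) (Inl y) = dX x y \<and> d (Inr x) (Inr y) = dX x y) \<and>
         (INF (x, y)\<in>X \<times> X. d (Inl x) (Inr y)) > 0}"

definition coarsely_equivalent_on :: "'c set \<Rightarrow> ('c \<Rightarrow> 'c \<Rightarrow> real) \<Rightarrow> ('c \<Rightarrow> 'c \<Rightarrow> real) \<Rightarrow> bool" where
  "coarsely_equivalent_on A b d \<longleftrightarrow>
     (\<exists>\<phi> \<psi>. mono_on {0..} \<phi> \<and> \<phi> ` {0..} \<subseteq> {0..} \<and> filterlim \<phi> at_top at_top \<and>
        mono_on {0..} \<psi> \<and> \<psi> ` {0..} \<subseteq> {0..} \<and> filterlim \<psi> at_top at_top \<and>
        (\<forall>p\<in>A. \<forall>q\<in>A. \<phi> (d p q) \<le> b p q \<and> b p q \<le> \<psi> (d p q)))"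

definition coarse_rel ::
  "'a set \<Rightarrow> ('a \<Rightarrow> 'a \<Rightarrow> real) \<Rightarrow> (('a + 'a \<Rightarrow> 'a + 'a \<Rightarrow> real) \<times> ('a + 'a \<Rightarrow> 'a + 'a \<Rightarrow> real)) set" where
  "coarse_rel X dX =
     {(b, d). b \<in> double_metrics X dX \<and> d \<in> double_metrics X dX \<and>
              coarsely_equivalent_on (X <+> X) b d}"

text \<open>
  The function on the double that restricts to \<open>dX\<close> on both copies and has the prescribed values
  \<open>d(x, y') = c x y\<close>. It is set to 0 off the double, because \<open>dX\<close> need not be symmetric or
  nonnegative outside \<open>X\<close>.
\<close>

definition double_dist ::
  "'a set \<Rightarrow> ('a \<Rightarrow> 'a \<Rightarrow> real) \<Rightarrow> ('a \<Rightarrow> 'a \<Rightarrow> real) \<Rightarrow> 'a + 'a \<Rightarrow> 'a + 'a \<Rightarrow> real" where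
  "double_dist X dX c p q =
     (if p \<in> X <+> X \<and> q \<in> X <+> X
      then (case (p, q) of
              (Inl x, Inl y) \<Rightarrow> dX x y
            | (Inr x, Inr y) \<Rightarrow> dX x y
            | (Inl x, Inr y) \<Rightarrow> c x y
            | (Inr x, Inl y) \<Rightarrow> c y x)
      else 0)"

definition double_comp ::
  "'a set \<Rightarrow> ('a \<Rightarrow> 'a \<Rightarrow> real) \<Rightarrow> ('a + 'a \<Rightarrow> 'a + 'a \<Rightarrow> real) \<Rightarrow> ('a + 'a \<Rightarrow> 'a + 'a \<Rightarrow> real) \<Rightarrow>
   'a + 'a \<Rightarrow> 'a + 'a \<Rightarrow> real" where
  "double_comp X dX \<rho> d =
     double_dist X dX (\<lambda>x z. INF y\<in>X. d (Inl x) (Inr y) + \<rho> (Inl y) (Inr z))"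

text \<open>
  The semigroup \<open>M(X)\<close>. The product of two classes is the union of the classes of \<open>\<rho> \<circ> d\<close> over all
  representatives; as composition respects coarse equivalence, this is a single class.
\<close>

definition double_semigroup ::
  "'a set \<Rightarrow> ('a \<Rightarrow> 'a \<Rightarrow> real) \<Rightarrow> ('a + 'a \<Rightarrow> 'a + 'a \<Rightarrow> real) set monoid" where
  "double_semigroup X dX =
     \<lparr>carrier = double_metrics X dX // coarse_rel X dX,
      monoid.mult = (\<lambda>s t. \<Union>\<rho>\<in>s. \<Union>d\<in>t. coarse_rel X dX `` {double_comp X dX \<rho> d}),
      one = coarse_rel X dX `` {double_dist X dX (\<lambda>x y. dX x y + 1)}\<rparr>"


section \<open>Finiteness in inverse semigroups\<close>

text \<open>
  The definitions are meant for inverse semigroups, i.e. semigroups in which every element has a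
  unique pseudo-inverse. For \<open>double_semigroup X dX\<close>, the pseudo-inverse of the class of \<open>d\<close> is the
  class of \<open>d\<^sup>*\<close>, where \<open>d\<^sup>*(x, y') = d(x', y)\<close>.
\<close>

definition pseudo_inverse :: "('a, 'b) monoid_scheme \<Rightarrow> 'a \<Rightarrow> 'a" where
  "pseudo_inverse S s =
     (THE t. t \<in> carrier S \<and> s \<otimes>\<^bsub>S\<^esub> t \<otimes>\<^bsub>S\<^esub> s = s \<and> t \<otimes>\<^bsub>S\<^esub> s \<otimes>\<^bsub>S\<^esub> t = t)"

definition idempotents :: "('a, 'b) monoid_scheme \<Rightarrow> 'a set" where
  "idempotents S = {e \<in> carrier S. e \<otimes>\<^bsub>S\<^esub> e = e}"

definition idem_le :: "('a, 'b) monoid_scheme \<Rightarrow> 'a \<Rightarrow> 'a \<Rightarrow> bool" where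
  "idem_le S f e \<longleftrightarrow> f = f \<otimes>\<^bsub>S\<^esub> e"

definition idem_equiv :: "('a, 'b) monoid_scheme \<Rightarrow> 'a \<Rightarrow> 'a \<Rightarrow> bool" where
  "idem_equiv S e f \<longleftrightarrow>
     (\<exists>s\<in>carrier S. pseudo_inverse S s \<otimes>\<^bsub>S\<^esub> s = e \<and> s \<otimes>\<^bsub>S\<^esub> pseudo_inverse S s = f)"

definition infinite_idempotent :: "('a, 'b) monoid_scheme \<Rightarrow> 'a \<Rightarrow> bool" where
  "infinite_idempotent S e \<longleftrightarrow>
     e \<in> idempotents S \<and> (\<exists>f\<in>idempotents S. idem_le S f e \<and> f \<noteq> e \<and> idem_equiv S f e)"

definition finite_idempotent :: "('a, 'b) monoid_scheme \<Rightarrow> 'a \<Rightarrow> bool" where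
  "finite_idempotent S e \<longleftrightarrow> e \<in> idempotents S \<and> \<not> infinite_idempotent S e"

definition weakly_finite :: "('a, 'b) monoid_scheme \<Rightarrow> bool" where
  "weakly_finite S \<longleftrightarrow>
     \<one>\<^bsub>S\<^esub> \<in> carrier S \<and>
     (\<forall>s\<in>carrier S. \<one>\<^bsub>S\<^esub> \<otimes>\<^bsub>S\<^esub> s = s \<and> s \<otimes>\<^bsub>S\<^esub> \<one>\<^bsub>S\<^esub> = s) \<and>
     finite_idempotent S \<one>\<^bsub>S\<^esub>"

end

(* Let iota map y in Y to g y and z in Z to h z. By (i2), (i3) and left invariance, iota changes
   distances by at most C and takes values in Y; by (i1) some points are arbitrarily far from Y.
   Gluing x to iota(x)' at distance C gives a class t in M(X) with t* t = 1, while t t* is not 1,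
   because points far from Y are far from their copies in the corresponding metric. So the unit
   is equivalent to the strictly smaller idempotent t t*. *)
theory Submission imports Defs begin

section \<open>Coarse equivalence\<close>

text \<open>\<open>pseudo_inverse\<close> is a definite description, so exhibiting
  \<open>d\<^sup>*\<close> is not enough: uniqueness has to be proved as well. This is done only for
  the one element \<open>s\<close> to which it is applied, the class of \<open>d\<^sup>*\<close>.
  Because \<open>s\<close> has a right inverse, each of its pseudo-inverses is a right inverse too,
  and right inverses of \<open>s\<close> are unique by a geometric argument. The second obstacle is
  the pair of control functions in coarse equivalence. They are traded for a condition without
  functions (bounds on one metric give bounds on the other), and for metrics on the double this
  concerns only distances between the two copies. Most equivalences then reduce to showing that
  these distances differ by at most an additive constant. The unit laws of the semigroup enter
  through the assumption, made for contradiction, that it is weakly finite.\<close>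

definition bounded_by :: "'c set \<Rightarrow> ('c \<Rightarrow> 'c \<Rightarrow> real) \<Rightarrow> ('c \<Rightarrow> 'c \<Rightarrow> real) \<Rightarrow> bool" where
  "bounded_by A b d \<longleftrightarrow> (\<forall>R. \<exists>R'. \<forall>p\<in>A. \<forall>q\<in>A. d p q \<le> R \<longrightarrow> b p q \<le> R')"

lemma bounded_by_imp_control:
  assumes "bounded_by A b d" and nonneg: "\<And>p q. p \<in> A \<Longrightarrow> q \<in> A \<Longrightarrow> 0 \<le> d p q"
  obtains \<psi> :: "real \<Rightarrow> real" where "mono \<psi>" "\<And>t. t \<le> \<psi> t" "\<And>t. 0 \<le> t \<Longrightarrow> 0 \<le> \<psi> t"
    "\<And>p q. p \<in> A \<Longrightarrow> q \<in> A \<Longrightarrow> b p q \<le> \<psi> (d p q)"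
proof
  \<comment> \<open>Inserting 0 keeps the set nonempty when no pair satisfies
    \<open>d p q \<le> t\<close>, and makes its supremum nonnegative.\<close>
  define B where "B t = insert 0 {b p q | p q. p \<in> A \<and> q \<in> A \<and> d p q \<le> t}" for t
  \<comment> \<open>The summand \<open>t\<close> sends \<open>\<psi>\<close> to infinity even if
    \<open>b\<close> is bounded.\<close>
  define \<psi> where "\<psi> t = t + Sup (B t)" for t
  have bdd: "bdd_above (B t)" for t
  proof -
    obtain R' where "\<forall>p\<in>A. \<forall>q\<in>A. d p q \<le> t \<longrightarrow> b p q \<le> R'"
      using assms(1) unfolding bounded_by_def by blast
    then have "\<forall>r\<in>B t. r \<le> max 0 R'"
      by (fastforce simp: B_def)
    then show ?thesis by (meson bdd_above.I)
  qed
  have sup0: "0 \<le> Sup (B t)" for t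
    by (rule cSup_upper[OF _ bdd]) (simp add: B_def)
  show "mono \<psi>"
  proof (rule monoI)
    fix s t :: real assume "s \<le> t"
    then have "B s \<subseteq> B t" by (fastforce simp: B_def)
    then have "Sup (B s) \<le> Sup (B t)"
      by (intro cSup_subset_mono bdd) (auto simp: B_def)
    with \<open>s \<le> t\<close> show "\<psi> s \<le> \<psi> t" by (simp add: \<psi>_def)
  qed
  show "t \<le> \<psi> t" for t using sup0[of t] by (simp add: \<psi>_def)
  show "0 \<le> \<psi> t" if "0 \<le> t" for t using sup0[of t] that by (simp add: \<psi>_def)
  show "b p q \<le> \<psi> (d p q)" if "p \<in> A" "q \<in> A" for p q
  proof -
    have "b p q \<le> Sup (B (d p q))"
      by (rule cSup_upper[OF _ bdd]) (use that in \<open>auto simp: B_def\<close>)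
    with nonneg[OF that] show ?thesis by (simp add: \<psi>_def)
  qed
qed

text \<open>A lower bound \<open>\<phi> (d p q) \<le> b p q\<close> with \<open>\<phi>\<close>
  tending to infinity carries the same information as an upper bound on \<open>d\<close> in terms of
  \<open>b\<close>. So each control function corresponds to one boundedness condition.\<close>

lemma coarsely_equivalent_on_iff:
  assumes b: "\<And>p q. p \<in> A \<Longrightarrow> q \<in> A \<Longrightarrow> 0 \<le> b p q"
    and d: "\<And>p q. p \<in> A \<Longrightarrow> q \<in> A \<Longrightarrow> 0 \<le> d p q"
  shows "coarsely_equivalent_on A b d \<longleftrightarrow> bounded_by A b d \<and> bounded_by A d b"
proof
  assume "coarsely_equivalent_on A b d"
  then obtain \<phi> \<psi> where lim: "filterlim \<phi> at_top at_top" and mono: "mono_on {0..} \<psi>"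
    and le: "\<And>p q. p \<in> A \<Longrightarrow> q \<in> A \<Longrightarrow> \<phi> (d p q) \<le> b p q \<and> b p q \<le> \<psi> (d p q)"
    unfolding coarsely_equivalent_on_def by blast
  \<comment> \<open>\<open>\<psi>\<close> is monotone only on the nonnegative reals, so
    \<open>R\<close> is clipped at 0.\<close>
  have "b p q \<le> \<psi> (max R 0)" if "p \<in> A" "q \<in> A" "d p q \<le> R" for p q R
  proof -
    have "\<psi> (d p q) \<le> \<psi> (max R 0)"
      by (rule mono_onD[OF mono]) (use that d in auto)
    with le[OF that(1,2)] show ?thesis by linarith
  qed
  moreover have "\<exists>R'. \<forall>p\<in>A. \<forall>q\<in>A. b p q \<le> R \<longrightarrow> d p q \<le> R'" for R
  proof -
    obtain T where T: "\<And>t. T \<le> t \<Longrightarrow> R + 1 \<le> \<phi> t"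
      using lim unfolding filterlim_at_top eventually_at_top_linorder by blast
    have "d p q \<le> T" if "p \<in> A" "q \<in> A" "b p q \<le> R" for p q
      using T[of "d p q"] le[OF that(1,2)] that(3) by linarith
    then show ?thesis by blast
  qed
  ultimately show "bounded_by A b d \<and> bounded_by A d b"
    unfolding bounded_by_def by blast
next
  assume "bounded_by A b d \<and> bounded_by A d b"
  then have bd: "bounded_by A b d" and db: "bounded_by A d b" by auto
  obtain \<psi> where \<psi>: "mono \<psi>" "\<And>t. t \<le> \<psi> t" "\<And>t. 0 \<le> t \<Longrightarrow> 0 \<le> \<psi> t"
    "\<And>p q. p \<in> A \<Longrightarrow> q \<in> A \<Longrightarrow> b p q \<le> \<psi> (d p q)"
    using bounded_by_imp_control[OF bd d] by blast
  obtain \<theta> where \<theta>: "mono \<theta>" "\<And>t. t \<le> \<theta> t" "\<And>t. 0 \<le> t \<Longrightarrow> 0 \<le> \<theta> t"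
    "\<And>p q. p \<in> A \<Longrightarrow> q \<in> A \<Longrightarrow> d p q \<le> \<theta> (b p q)"
    using bounded_by_imp_control[OF db b] by blast
  \<comment> \<open>The lower control function is the generalised inverse of \<open>\<theta>\<close>.\<close>
  define \<phi> where "\<phi> s = Inf {t. 0 \<le> t \<and> s \<le> \<theta> t}" for s
  have ne: "{t. 0 \<le> t \<and> s \<le> \<theta> t} \<noteq> {}" for s
    using \<theta>(2)[of "max s 0"] by (auto intro!: exI[of _ "max s 0"])
  have bdd: "bdd_below {t. 0 \<le> t \<and> s \<le> \<theta> t}" for s by (auto intro: bdd_belowI)
  have \<phi>_ge: "r \<le> \<phi> s" if "\<And>t. 0 \<le> t \<Longrightarrow> s \<le> \<theta> t \<Longrightarrow> r \<le> t" for r s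
    unfolding \<phi>_def by (rule cInf_greatest[OF ne]) (use that in auto)
  have \<phi>_le: "\<phi> s \<le> t" if "0 \<le> t" "s \<le> \<theta> t" for s t
    unfolding \<phi>_def by (rule cInf_lower[OF _ bdd]) (use that in auto)
  have "mono_on {0..} \<phi>"
  proof (rule mono_onI)
    fix r s :: real assume "r \<le> s"
    then show "\<phi> r \<le> \<phi> s" by (intro \<phi>_ge \<phi>_le) auto
  qed
  moreover have "\<phi> ` {0..} \<subseteq> {0..}" by (auto intro: \<phi>_ge)
  moreover have "filterlim \<phi> at_top at_top"
    unfolding filterlim_at_top eventually_at_top_linorder
  proof
    fix N
    \<comment> \<open>Any \<open>t < N\<close> has \<open>\<theta> t \<le> \<theta> N < s\<close>,
      so it lies outside the set whose infimum is \<open>\<phi> s\<close>.\<close>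
    have "N \<le> \<phi> s" if "\<theta> N + 1 \<le> s" for s
    proof (rule \<phi>_ge)
      fix t assume "0 \<le> t" "s \<le> \<theta> t"
      show "N \<le> t"
      proof (rule ccontr)
        assume "\<not> N \<le> t"
        then have "\<theta> t \<le> \<theta> N" by (intro monoD[OF \<theta>(1)]) simp
        with that \<open>s \<le> \<theta> t\<close> show False by linarith
      qed
    qed
    then show "\<exists>T. \<forall>s\<ge>T. N \<le> \<phi> s" by blast
  qed
  moreover have "mono_on {0..} \<psi>" using \<psi>(1) by (rule mono_imp_mono_on)
  moreover have "\<psi> ` {0..} \<subseteq> {0..}" using \<psi>(3) by auto
  moreover have "filterlim \<psi> at_top at_top"
    by (rule filterlim_at_top_mono[OF filterlim_ident]) (simp add: \<psi>(2))
  moreover have "\<phi> (d p q) \<le> b p q \<and> b p q \<le> \<psi> (d p q)" if "p \<in> A" "q \<in> A" for p q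
    using \<phi>_le[OF b \<theta>(4)] \<psi>(4) that by blast
  ultimately show "coarsely_equivalent_on A b d"
    unfolding coarsely_equivalent_on_def by blast
qed


section \<open>The semigroup of the double\<close>

text \<open>
  \<^locale>\<open>Metric_space\<close> is too strong here: a word metric satisfies the axioms only on the carrier.
\<close>

locale metric_double =
  fixes X :: "'a set" and dX :: "'a \<Rightarrow> 'a \<Rightarrow> real"
  assumes nonempty: "X \<noteq> {}"
    and dX_nonneg: "x \<in> X \<Longrightarrow> y \<in> X \<Longrightarrow> 0 \<le> dX x y"
    and dX_zero: "x \<in> X \<Longrightarrow> y \<in> X \<Longrightarrow> dX x y = 0 \<longleftrightarrow> x = y"
    and dX_sym: "x \<in> X \<Longrightarrow> y \<in> X \<Longrightarrow> dX x y = dX y x"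
    and dX_triangle: "x \<in> X \<Longrightarrow> y \<in> X \<Longrightarrow> z \<in> X \<Longrightarrow> dX x z \<le> dX x y + dX y z"
begin

abbreviation DM where "DM \<equiv> double_metrics X dX"
abbreviation cross :: "('a + 'a \<Rightarrow> 'a + 'a \<Rightarrow> real) \<Rightarrow> 'a \<Rightarrow> 'a \<Rightarrow> real" where
  "cross d x y \<equiv> d (Inl x) (Inr y)"
abbreviation cls where "cls d \<equiv> coarse_rel X dX `` {d}"
abbreviation comp where "comp \<equiv> double_comp X dX"

lemma dX_self [simp]: "x \<in> X \<Longrightarrow> dX x x = 0"
  by (simp add: dX_zero)

lemma double_dist_simps [simp]:
  assumes "x \<in> X" "y \<in> X"
  shows "double_dist X dX c (Inl x) (Inl y) = dX x y"
    "double_dist X dX c (Inr x) (Inr y) = dX x y"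
    "double_dist X dX c (Inl x) (Inr y) = c x y"
    "double_dist X dX c (Inr x) (Inl y) = c y x"
  using assms by (auto simp: double_dist_def)

lemma DM_same_copy:
  "d \<in> DM \<Longrightarrow> x \<in> X \<Longrightarrow> y \<in> X \<Longrightarrow> d (Inl x) (Inl y) = dX x y"
  "d \<in> DM \<Longrightarrow> x \<in> X \<Longrightarrow> y \<in> X \<Longrightarrow> d (Inr x) (Inr y) = dX x y"
  by (auto simp: double_metrics_def)

lemma DM_nonneg: "d \<in> DM \<Longrightarrow> 0 \<le> d p q"
  by (auto simp: double_metrics_def intro: Metric_space.nonneg)

lemma DM_commute: "d \<in> DM \<Longrightarrow> d p q = d q p"
  by (auto simp: double_metrics_def intro: Metric_space.commute)

lemma DM_triangle:
  "d \<in> DM \<Longrightarrow> p \<in> X <+> X \<Longrightarrow> q \<in> X <+> X \<Longrightarrow> r \<in> X <+> X \<Longrightarrow> d p r \<le> d p q + d q r"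
  by (auto simp: double_metrics_def intro: Metric_space.triangle)

lemma cross_triangle:
  assumes "d \<in> DM" "x \<in> X" "y \<in> X" "u \<in> X"
  shows "cross d x y \<le> dX x u + cross d u y"
    and "cross d x y \<le> cross d x u + dX u y"
    and "dX x u \<le> cross d x y + cross d u y"
    and "dX y u \<le> cross d x y + cross d x u"
  using assms DM_triangle[of d "Inl x" "Inl u" "Inr y"] DM_triangle[of d "Inl x" "Inr u" "Inr y"]
    DM_triangle[of d "Inl x" "Inr y" "Inl u"] DM_triangle[of d "Inr y" "Inl x" "Inr u"]
    DM_commute[of d "Inr y" "Inl u"] DM_commute[of d "Inr y" "Inl x"]
  by (auto simp: DM_same_copy)

lemma cross_ge:
  assumes "d \<in> DM"
  obtains \<epsilon> where "0 < \<epsilon>" "\<And>x y. x \<in> X \<Longrightarrow> y \<in> X \<Longrightarrow> \<epsilon> \<le> cross d x y"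
proof
  show "0 < (INF (x, y)\<in>X \<times> X. cross d x y)"
    using assms by (simp add: double_metrics_def)
  have "bdd_below ((\<lambda>(x, y). cross d x y) ` (X \<times> X))"
    using DM_nonneg[OF assms] by (auto intro!: bdd_belowI)
  from cINF_lower[OF this]
  show "(INF (x, y)\<in>X \<times> X. cross d x y) \<le> cross d x y" if "x \<in> X" "y \<in> X" for x y
    using that by force
qed

text \<open>A triangle meeting both copies has two vertices in one of them, and its long side either
  crosses or stays inside a copy: these are the four cases of \<open>tri\<close>. The uniform
  \<open>\<epsilon>\<close> yields both the positive infimum and the positivity of distances between
  the copies.\<close>

lemma double_dist_in_DM:
  assumes eps: "0 < \<epsilon>" "\<And>x y. x \<in> X \<Longrightarrow> y \<in> X \<Longrightarrow> \<epsilon> \<le> c x y"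
    and tri: "\<And>x u y. x \<in> X \<Longrightarrow> u \<in> X \<Longrightarrow> y \<in> X \<Longrightarrow> c x y \<le> dX x u + c u y"
    "\<And>x u y. x \<in> X \<Longrightarrow> u \<in> X \<Longrightarrow> y \<in> X \<Longrightarrow> c x y \<le> c x u + dX u y"
    "\<And>x u y. x \<in> X \<Longrightarrow> u \<in> X \<Longrightarrow> y \<in> X \<Longrightarrow> dX x u \<le> c x y + c u y"
    "\<And>x u y. x \<in> X \<Longrightarrow> u \<in> X \<Longrightarrow> y \<in> X \<Longrightarrow> dX y u \<le> c x y + c x u"
  shows "double_dist X dX c \<in> DM"
proof -
  let ?d = "double_dist X dX c"
  have pos: "0 < c x y" if "x \<in> X" "y \<in> X" for x y
    using eps(1) eps(2)[OF that] by linarith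
  have "Metric_space (X <+> X) ?d"
  proof
    fix p q
    show "0 \<le> ?d p q"
      using dX_nonneg less_imp_le[OF pos] by (auto simp: double_dist_def split: sum.splits)
    show "?d p q = ?d q p"
      using dX_sym by (auto simp: double_dist_def split: sum.splits)
    show "?d p q = 0 \<longleftrightarrow> p = q" if "p \<in> X <+> X" "q \<in> X <+> X"
      using that dX_zero less_imp_neq[OF pos] by fastforce
  next
    \<comment> \<open>The same two inequalities for paths that start in the second copy.\<close>
    have swapped: "c x y \<le> c u y + dX u x" "c x y \<le> dX y u + c x u"
      if "x \<in> X" "u \<in> X" "y \<in> X" for x u y
      using tri(1)[OF that] tri(2)[OF that] dX_sym that by auto
    fix p q r assume "p \<in> X <+> X" "q \<in> X <+> X" "r \<in> X <+> X"
    then show "?d p r \<le> ?d p q + ?d q r"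
      by (elim PlusE) (simp_all add: dX_triangle tri swapped)
  qed
  moreover have "\<epsilon> \<le> (INF (x, y)\<in>X \<times> X. cross ?d x y)"
    using nonempty by (intro cINF_greatest) (auto simp: eps(2))
  ultimately show ?thesis
    using eps(1) by (auto simp: double_metrics_def)
qed

section \<open>Coarse equivalence in terms of the distances between the copies\<close>

definition dominated :: "('a + 'a \<Rightarrow> 'a + 'a \<Rightarrow> real) \<Rightarrow> ('a + 'a \<Rightarrow> 'a + 'a \<Rightarrow> real) \<Rightarrow> bool" where
  "dominated b d \<longleftrightarrow> (\<forall>R. \<exists>R'. \<forall>x\<in>X. \<forall>y\<in>X. cross d x y \<le> R \<longrightarrow> cross b x y \<le> R')"

lemma dominatedD:
  assumes "dominated b d"
  obtains R' where "\<And>x y. x \<in> X \<Longrightarrow> y \<in> X \<Longrightarrow> cross d x y \<le> R \<Longrightarrow> cross b x y \<le> R'"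
  using assms unfolding dominated_def by blast

lemma dominatedI_add:
  assumes "\<And>x y. x \<in> X \<Longrightarrow> y \<in> X \<Longrightarrow> cross b x y \<le> cross d x y + K"
  shows "dominated b d"
  unfolding dominated_def
proof
  fix R
  have "cross b x y \<le> R + K" if "x \<in> X" "y \<in> X" "cross d x y \<le> R" for x y
    using assms[OF that(1,2)] that(3) by linarith
  then show "\<exists>R'. \<forall>x\<in>X. \<forall>y\<in>X. cross d x y \<le> R \<longrightarrow> cross b x y \<le> R'" by blast
qed

lemma dominated_trans: "dominated a b \<Longrightarrow> dominated b d \<Longrightarrow> dominated a d"
  unfolding dominated_def by meson

text \<open>Inside a copy both metrics equal \<open>dX\<close>, so a bound \<open>R\<close> there
  transfers unchanged; only crossing pairs need \<open>R'\<close>.\<close>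

lemma bounded_by_iff_dominated:
  assumes "b \<in> DM" "d \<in> DM"
  shows "bounded_by (X <+> X) b d \<longleftrightarrow> dominated b d"
proof
  show "dominated b d" if "bounded_by (X <+> X) b d"
    using that unfolding bounded_by_def dominated_def by (meson InlI InrI)
  show "bounded_by (X <+> X) b d" if dom: "dominated b d"
    unfolding bounded_by_def
  proof
    fix R
    obtain R' where R': "\<And>x y. x \<in> X \<Longrightarrow> y \<in> X \<Longrightarrow> cross d x y \<le> R \<Longrightarrow> cross b x y \<le> R'"
      using dominatedD[OF dom] by blast
    have "b p q \<le> max R R'" if "p \<in> X <+> X" "q \<in> X <+> X" "d p q \<le> R" for p q
      using that
      by (auto simp: DM_same_copy assms le_max_iff_disj R'
          DM_commute[OF assms(1), of "Inr _" "Inl _"] DM_commute[OF assms(2), of "Inr _" "Inl _"])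
    then show "\<exists>R'. \<forall>p\<in>X <+> X. \<forall>q\<in>X <+> X. d p q \<le> R \<longrightarrow> b p q \<le> R'" by blast
  qed
qed

lemma coarse_rel_iff:
  "(b, d) \<in> coarse_rel X dX \<longleftrightarrow> b \<in> DM \<and> d \<in> DM \<and> dominated b d \<and> dominated d b"
  using coarsely_equivalent_on_iff[of "X <+> X" b d] DM_nonneg
  by (auto simp: coarse_rel_def bounded_by_iff_dominated)

lemma equiv_coarse_rel: "equiv DM (coarse_rel X dX)"
proof (rule equivI)
  have "dominated d d" for d by (rule dominatedI_add[where K = 0]) simp
  then show "refl_on DM (coarse_rel X dX)" by (auto simp: refl_on_def coarse_rel_iff)
  show "sym (coarse_rel X dX)" by (auto simp: sym_def coarse_rel_iff)
  show "trans (coarse_rel X dX)"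
    by (rule transI) (auto simp: coarse_rel_iff intro: dominated_trans)
  show "coarse_rel X dX \<subseteq> DM \<times> DM" by (auto simp: coarse_rel_iff)
qed

lemma cls_eqI: "b \<in> DM \<Longrightarrow> d \<in> DM \<Longrightarrow> dominated b d \<Longrightarrow> dominated d b \<Longrightarrow> cls b = cls d"
  by (rule equiv_class_eq[OF equiv_coarse_rel]) (simp add: coarse_rel_iff)

lemma cls_eqD: "cls b = cls d \<Longrightarrow> d \<in> DM \<Longrightarrow> dominated b d"
  using eq_equiv_class[OF _ equiv_coarse_rel] by (force simp: coarse_rel_iff)

section \<open>Composition of metrics on the double\<close>

lemma comp_cross_le:
  assumes "\<rho> \<in> DM" "d \<in> DM" "x \<in> X" "y \<in> X" "z \<in> X"
  shows "cross (comp \<rho> d) x z \<le> cross d x y + cross \<rho> y z"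
proof -
  have "bdd_below ((\<lambda>y. cross d x y + cross \<rho> y z) ` X)"
    using assms DM_nonneg by (intro bdd_belowI2[of _ 0]) auto
  then show ?thesis
    using assms by (auto simp: double_comp_def intro: cINF_lower)
qed

text \<open>The infimum need not be attained, so a middle point is available only below a strict
  bound. This is the origin of the slack \<open>+ 1\<close> in later uses.\<close>

lemma comp_cross_lessD:
  assumes "\<rho> \<in> DM" "d \<in> DM" "x \<in> X" "z \<in> X" "cross (comp \<rho> d) x z < R"
  obtains y where "y \<in> X" "cross d x y + cross \<rho> y z < R"
proof -
  have "bdd_below ((\<lambda>y. cross d x y + cross \<rho> y z) ` X)"
    using assms DM_nonneg by (intro bdd_belowI2[of _ 0]) auto
  then show ?thesis
    using assms that nonempty by (auto simp: double_comp_def cINF_less_iff)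
qed

lemma comp_cross_geI:
  assumes "x \<in> X" "z \<in> X" "\<And>y. y \<in> X \<Longrightarrow> r \<le> cross d x y + cross \<rho> y z"
  shows "r \<le> cross (comp \<rho> d) x z"
  using assms nonempty by (auto simp: double_comp_def intro: cINF_greatest)

text \<open>Picture three copies of \<open>X\<close> in a row, the first two glued by
  \<open>d\<close> and the last two by \<open>\<rho>\<close>; the composition measures paths from
  the first to the third. Each triangle inequality is checked for fixed middle points before passing
  to infima.\<close>

lemma comp_in_DM:
  assumes r: "\<rho> \<in> DM" and d: "d \<in> DM"
  shows "comp \<rho> d \<in> DM"
proof -
  let ?c = "cross (comp \<rho> d)"
  obtain \<epsilon> where eps: "0 < \<epsilon>" "\<And>x y. x \<in> X \<Longrightarrow> y \<in> X \<Longrightarrow> \<epsilon> \<le> cross d x y"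
    using cross_ge[OF d] by blast
  have "double_dist X dX (\<lambda>x z. INF y\<in>X. cross d x y + cross \<rho> y z) \<in> DM"
  proof (rule double_dist_in_DM[OF eps(1)])
    let ?i = "\<lambda>x z. INF y\<in>X. cross d x y + cross \<rho> y z"
    have c: "?i x z = ?c x z" if "x \<in> X" "z \<in> X" for x z
      using that by (simp add: double_comp_def)
    fix x y assume xy: "x \<in> X" "y \<in> X"
    have "\<epsilon> \<le> cross d x w + cross \<rho> w y" if "w \<in> X" for w
      using eps(2)[OF xy(1) that] DM_nonneg[OF r, of "Inl w" "Inr y"] by linarith
    then show "\<epsilon> \<le> ?i x y"
      using comp_cross_geI xy by (simp add: c)
    fix u assume u: "u \<in> X"
    have "?c x y - dX x u \<le> ?c u y"
    proof (rule comp_cross_geI[OF u xy(2)])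
      fix w assume w: "w \<in> X"
      show "?c x y - dX x u \<le> cross d u w + cross \<rho> w y"
        using comp_cross_le[OF r d xy(1) w xy(2)] cross_triangle(1)[OF d xy(1) w u] by linarith
    qed
    then show "?i x y \<le> dX x u + ?i u y" using xy u by (simp add: c)
    have "?c x y - dX u y \<le> ?c x u"
    proof (rule comp_cross_geI[OF xy(1) u])
      fix w assume w: "w \<in> X"
      show "?c x y - dX u y \<le> cross d x w + cross \<rho> w u"
        using comp_cross_le[OF r d xy(1) w xy(2)] cross_triangle(2)[OF r w xy(2) u] by linarith
    qed
    then show "?i x y \<le> ?i x u + dX u y" using xy u by (simp add: c)
    have "dX x u - ?c u y \<le> ?c x y"
    proof (rule comp_cross_geI[OF xy])
      fix w assume w: "w \<in> X"
      \<comment> \<open>The paths through \<open>w\<close> and \<open>v\<close> are compared in the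
        middle copy: their \<open>\<rho>\<close> legs meet in \<open>y\<close>, which bounds
        \<open>dX w v\<close>. The last inequality is the mirror image, with the \<open>d\<close>
        legs bounding \<open>dX w v\<close>.\<close>
      have "dX x u - (cross d x w + cross \<rho> w y) \<le> ?c u y"
      proof (rule comp_cross_geI[OF u xy(2)])
        fix v assume v: "v \<in> X"
        show "dX x u - (cross d x w + cross \<rho> w y) \<le> cross d u v + cross \<rho> v y"
          using cross_triangle(3)[OF d xy(1) v u] cross_triangle(2)[OF d xy(1) v w]
            cross_triangle(3)[OF r w xy(2) v] by linarith
      qed
      then show "dX x u - ?c u y \<le> cross d x w + cross \<rho> w y" by linarith
    qed
    then show "dX x u \<le> ?i x y + ?i u y" using xy u by (simp add: c)
    have "dX y u - ?c x u \<le> ?c x y"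
    proof (rule comp_cross_geI[OF xy])
      fix w assume w: "w \<in> X"
      have "dX y u - (cross d x w + cross \<rho> w y) \<le> ?c x u"
      proof (rule comp_cross_geI[OF xy(1) u])
        fix v assume v: "v \<in> X"
        show "dX y u - (cross d x w + cross \<rho> w y) \<le> cross d x v + cross \<rho> v u"
          using cross_triangle(4)[OF r w xy(2) u] cross_triangle(1)[OF r w u v]
            cross_triangle(4)[OF d xy(1) w v] by linarith
      qed
      then show "dX y u - ?c x u \<le> cross d x w + cross \<rho> w y" by linarith
    qed
    then show "dX y u \<le> ?i x y + ?i x u" using xy u by (simp add: c)
  qed
  then show ?thesis by (simp add: double_comp_def)
qed

text \<open>Each leg of a nearly optimal path is no longer than the path, so domination applies to
  both legs at the same middle point.\<close>

lemma comp_dominated: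
  assumes DM: "\<rho> \<in> DM" "d \<in> DM" "\<rho>' \<in> DM" "d' \<in> DM"
    and dom: "dominated \<rho>' \<rho>" "dominated d' d"
  shows "dominated (comp \<rho>' d') (comp \<rho> d)"
  unfolding dominated_def
proof
  fix R
  obtain A where A: "\<And>x y. x \<in> X \<Longrightarrow> y \<in> X \<Longrightarrow> cross \<rho> x y \<le> R + 1 \<Longrightarrow> cross \<rho>' x y \<le> A"
    using dominatedD[OF dom(1)] by blast
  obtain B where B: "\<And>x y. x \<in> X \<Longrightarrow> y \<in> X \<Longrightarrow> cross d x y \<le> R + 1 \<Longrightarrow> cross d' x y \<le> B"
    using dominatedD[OF dom(2)] by blast
  have "cross (comp \<rho>' d') x z \<le> B + A"
    if x: "x \<in> X" and z: "z \<in> X" and le: "cross (comp \<rho> d) x z \<le> R" for x z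
  proof -
    obtain y where y: "y \<in> X" "cross d x y + cross \<rho> y z < R + 1"
      using comp_cross_lessD[OF DM(1,2) x z, of "R + 1"] le by auto
    have "cross d' x y \<le> B"
      by (rule B[OF x y(1)]) (use y DM_nonneg[OF DM(1), of "Inl y" "Inr z"] in linarith)
    moreover have "cross \<rho>' y z \<le> A"
      by (rule A[OF y(1) z]) (use y DM_nonneg[OF DM(2), of "Inl x" "Inr y"] in linarith)
    ultimately show ?thesis
      using comp_cross_le[OF DM(3,4) x y(1) z] by linarith
  qed
  then show "\<exists>R'. \<forall>x\<in>X. \<forall>y\<in>X. cross (comp \<rho> d) x y \<le> R \<longrightarrow> cross (comp \<rho>' d') x y \<le> R'"
    by blast
qed

section \<open>Multiplication of classes and the unit\<close>

abbreviation M where "M \<equiv> double_semigroup X dX"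

text \<open>All classes in the union that defines the product coincide, by
  \<open>comp_dominated\<close> in both directions, and the union is over nonempty index
  sets.\<close>

lemma mult_cls:
  assumes "\<rho> \<in> DM" "d \<in> DM"
  shows "cls \<rho> \<otimes>\<^bsub>M\<^esub> cls d = cls (comp \<rho> d)"
proof -
  have "cls (comp \<rho>' d') = cls (comp \<rho> d)" if "\<rho>' \<in> cls \<rho>" "d' \<in> cls d" for \<rho>' d'
    using that assms by (intro cls_eqI comp_in_DM comp_dominated) (auto simp: coarse_rel_iff)
  moreover have "cls \<rho> \<noteq> {}" "cls d \<noteq> {}"
    using assms equiv_class_self[OF equiv_coarse_rel] by blast+
  ultimately have "(\<Union>\<rho>'\<in>cls \<rho>. \<Union>d'\<in>cls d. cls (comp \<rho>' d')) = cls (comp \<rho> d)"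
    by (intro SUP_eq_const)
  then show ?thesis by (simp add: double_semigroup_def)
qed

lemma cls_in_carrier: "d \<in> DM \<Longrightarrow> cls d \<in> carrier M"
  by (simp add: double_semigroup_def quotientI)

lemma carrierE:
  assumes "s \<in> carrier M"
  obtains d where "d \<in> DM" "s = cls d"
  using assms by (auto simp: double_semigroup_def elim: quotientE)

lemma mult_closed: "s \<in> carrier M \<Longrightarrow> t \<in> carrier M \<Longrightarrow> s \<otimes>\<^bsub>M\<^esub> t \<in> carrier M"
  by (metis carrierE cls_in_carrier comp_in_DM mult_cls)

text \<open>Both sides are the infimum of \<open>cross d x y + cross b y v + cross a v z\<close>
  over the two middle points \<open>y\<close> and \<open>v\<close>.\<close>

lemma comp_assoc:
  assumes DM: "a \<in> DM" "b \<in> DM" "d \<in> DM" and x: "x \<in> X" and z: "z \<in> X"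
  shows "cross (comp (comp a b) d) x z = cross (comp a (comp b d)) x z"
proof (rule antisym; rule comp_cross_geI[OF x z])
  fix v assume v: "v \<in> X"
  have "cross (comp (comp a b) d) x z - cross a v z \<le> cross (comp b d) x v"
  proof (rule comp_cross_geI[OF x v])
    fix y assume y: "y \<in> X"
    show "cross (comp (comp a b) d) x z - cross a v z \<le> cross d x y + cross b y v"
      using comp_cross_le[OF comp_in_DM[OF DM(1,2)] DM(3) x y z]
        comp_cross_le[OF DM(1,2) y v z] by linarith
  qed
  then show "cross (comp (comp a b) d) x z \<le> cross (comp b d) x v + cross a v z" by linarith
  have "cross (comp a (comp b d)) x z - cross d x v \<le> cross (comp a b) v z"
  proof (rule comp_cross_geI[OF v z])
    fix y assume y: "y \<in> X"
    show "cross (comp a (comp b d)) x z - cross d x v \<le> cross b v y + cross a y z"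
      using comp_cross_le[OF DM(1) comp_in_DM[OF DM(2,3)] x y z]
        comp_cross_le[OF DM(2,3) x v y] by linarith
  qed
  then show "cross (comp a (comp b d)) x z \<le> cross d x v + cross (comp a b) v z" by linarith
qed

lemma mult_assoc:
  assumes "r \<in> carrier M" "s \<in> carrier M" "t \<in> carrier M"
  shows "r \<otimes>\<^bsub>M\<^esub> s \<otimes>\<^bsub>M\<^esub> t = r \<otimes>\<^bsub>M\<^esub> (s \<otimes>\<^bsub>M\<^esub> t)"
proof -
  obtain a b d where DM: "a \<in> DM" "b \<in> DM" "d \<in> DM" and eq: "r = cls a" "s = cls b" "t = cls d"
    by (metis assms carrierE)
  have "cls (comp (comp a b) d) = cls (comp a (comp b d))"
    by (intro cls_eqI comp_in_DM DM; rule dominatedI_add[where K = 0]; simp add: comp_assoc DM)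
  then show ?thesis by (simp add: eq mult_cls comp_in_DM DM)
qed

lemma unit_in_DM: "double_dist X dX (\<lambda>x y. dX x y + 1) \<in> DM"
proof (rule double_dist_in_DM[of 1])
  fix x u y assume X: "x \<in> X" "u \<in> X" "y \<in> X"
  show "dX x u \<le> dX x y + 1 + (dX u y + 1)" "dX y u \<le> dX x y + 1 + (dX x u + 1)"
    using dX_triangle[of x y u] dX_triangle[of y x u] dX_sym[of u y] dX_sym[of x y] X by auto
qed (auto simp: dX_nonneg dX_triangle)

lemma one_eq: "\<one>\<^bsub>M\<^esub> = cls (double_dist X dX (\<lambda>x y. dX x y + 1))"
  by (simp add: double_semigroup_def)

text \<open>
  The metric \<open>d\<close> below glues \<open>x\<close> to the point \<open>(\<iota> x)'\<close> at distance \<open>C\<close>; it is a metric because \<open>\<iota>\<close>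
  distorts distances by at most \<open>C\<close>. Its class is a right inverse of the class of \<open>d\<^sup>*\<close>.
\<close>

lemma infinite_unit:
  fixes \<iota> :: "'a \<Rightarrow> 'a"
  assumes unital: "\<one>\<^bsub>M\<^esub> \<in> carrier M"
      "\<And>s. s \<in> carrier M \<Longrightarrow> \<one>\<^bsub>M\<^esub> \<otimes>\<^bsub>M\<^esub> s = s \<and> s \<otimes>\<^bsub>M\<^esub> \<one>\<^bsub>M\<^esub> = s"
    and maps: "\<And>x. x \<in> X \<Longrightarrow> \<iota> x \<in> X"
    and C: "0 < C" "\<And>x y. x \<in> X \<Longrightarrow> y \<in> X \<Longrightarrow> \<bar>dX (\<iota> x) (\<iota> y) - dX x y\<bar> \<le> C"
    and far: "\<And>D. \<exists>z\<in>X. \<forall>x\<in>X. D \<le> dX z (\<iota> x)"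
  shows "infinite_idempotent M \<one>\<^bsub>M\<^esub>"
proof -
  \<comment> \<open>The cheapest route from \<open>x\<close> to \<open>y'\<close>: walk to some
    \<open>u\<close>, jump to \<open>(\<iota> u)'\<close> at cost \<open>C\<close>, then walk to
    \<open>y'\<close>.\<close>
  define c where "c x y = (INF u\<in>X. dX x u + C + dX (\<iota> u) y)" for x y
  have c_le: "c x y \<le> dX x u + C + dX (\<iota> u) y" if "x \<in> X" "y \<in> X" "u \<in> X" for x y u
    unfolding c_def using that C maps dX_nonneg
    by (intro cINF_lower bdd_belowI2[of _ 0]) auto
  have c_ge: "r \<le> c x y" if "\<And>u. u \<in> X \<Longrightarrow> r \<le> dX x u + C + dX (\<iota> u) y" for r x y
    unfolding c_def using that nonempty by (rule cINF_greatest[rotated])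
  define d where "d = double_dist X dX c"
  \<comment> \<open>Transposed crossing distances: this is \<open>d\<^sup>*\<close>.\<close>
  define \<rho> where "\<rho> = double_dist X dX (\<lambda>x y. c y x)"
  have tri: "c x y \<le> dX x u + c u y" "c x y \<le> c x u + dX u y"
    "dX x u \<le> c x y + c u y" "dX y u \<le> c x y + c x u" "C \<le> c x y"
    if X: "x \<in> X" "u \<in> X" "y \<in> X" for x u y
  proof -
    have "c x y - dX x u \<le> c u y"
    proof (rule c_ge)
      fix w assume w: "w \<in> X"
      show "c x y - dX x u \<le> dX u w + C + dX (\<iota> w) y"
        using c_le[OF X(1,3) w] dX_triangle[OF X(1,2) w] by linarith
    qed
    then show "c x y \<le> dX x u + c u y" by linarith
    have "c x y - dX u y \<le> c x u"
    proof (rule c_ge)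
      fix w assume w: "w \<in> X"
      show "c x y - dX u y \<le> dX x w + C + dX (\<iota> w) u"
        using c_le[OF X(1,3) w] dX_triangle[OF maps[OF w] X(2,3)] by linarith
    qed
    then show "c x y \<le> c x u + dX u y" by linarith
    \<comment> \<open>The routes from \<open>x\<close> via \<open>w\<close> and from
      \<open>u\<close> via \<open>v\<close> meet in \<open>y'\<close>. Replacing
      \<open>dX w v\<close> by \<open>dX (\<iota> w) (\<iota> v)\<close> costs at most
      \<open>C\<close>, which the two jumps, worth \<open>2 * C\<close>, cover. This motivates the
      jump cost.\<close>
    have "dX x u - c u y \<le> c x y"
    proof (rule c_ge)
      fix w assume w: "w \<in> X"
      have "dX x u - (dX x w + C + dX (\<iota> w) y) \<le> c u y"
      proof (rule c_ge)
        fix v assume v: "v \<in> X"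
        show "dX x u - (dX x w + C + dX (\<iota> w) y) \<le> dX u v + C + dX (\<iota> v) y"
          using dX_triangle[OF X(1) w X(2)] dX_triangle[OF w v X(2)] dX_sym[OF X(2) v]
            dX_triangle[OF maps[OF w] X(3) maps[OF v]] dX_sym[OF X(3) maps[OF v]]
            C(1) C(2)[OF w v] by linarith
      qed
      then show "dX x u - c u y \<le> dX x w + C + dX (\<iota> w) y" by linarith
    qed
    then show "dX x u \<le> c x y + c u y" by linarith
    \<comment> \<open>The dual case: the routes share their start, and the other half of the
      distortion bound is used.\<close>
    have "dX y u - c x u \<le> c x y"
    proof (rule c_ge)
      fix w assume w: "w \<in> X"
      have "dX y u - (dX x w + C + dX (\<iota> w) y) \<le> c x u"
      proof (rule c_ge)
        fix v assume v: "v \<in> X"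
        show "dX y u - (dX x w + C + dX (\<iota> w) y) \<le> dX x v + C + dX (\<iota> v) u"
          using dX_triangle[OF X(3) maps[OF w] X(2)] dX_triangle[OF maps[OF w] maps[OF v] X(2)]
            dX_sym[OF X(3) maps[OF w]] dX_triangle[OF w X(1) v] dX_sym[OF X(1) w]
            C(1) C(2)[OF w v] by linarith
      qed
      then show "dX y u - c x u \<le> dX x w + C + dX (\<iota> w) y" by linarith
    qed
    then show "dX y u \<le> c x y + c x u" by linarith
    have "C \<le> dX x w + C + dX (\<iota> w) y" if "w \<in> X" for w
      using dX_nonneg[OF X(1) that] dX_nonneg[OF maps[OF that] X(3)] by linarith
    then show "C \<le> c x y" by (rule c_ge)
  qed
  have d: "d \<in> DM"
    unfolding d_def by (rule double_dist_in_DM[OF C(1)]) (auto intro: tri)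
  have \<rho>: "\<rho> \<in> DM"
    unfolding \<rho>_def
  proof (rule double_dist_in_DM[OF C(1)])
    fix x u y assume X: "x \<in> X" "u \<in> X" "y \<in> X"
    show "c y x \<le> dX x u + c y u" "c y x \<le> c u x + dX u y"
      using tri(2)[OF X(3,2,1)] tri(1)[OF X(3,2,1)] dX_sym[OF X(1,2)] dX_sym[OF X(2,3)] by auto
  qed (auto intro: tri)
  have cross_d: "cross d x y = c x y" and cross_\<rho>: "cross \<rho> x y = c y x"
    if "x \<in> X" "y \<in> X" for x y
    using that by (simp_all add: d_def \<rho>_def)
  have c_iota: "c x (\<iota> x) \<le> C" if "x \<in> X" for x
    using c_le[OF that maps[OF that] that] that maps by simp

  let ?e = "double_dist X dX (\<lambda>x y. dX x y + 1)"
  \<comment> \<open>Here \<open>s\<close> is the adjoint of \<open>t\<close>. It serves as the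
    witness that \<open>f\<close> is equivalent to the unit, so the pseudo-inverse to be identified
    is that of \<open>s\<close>.\<close>
  define s where "s = cls \<rho>"
  define t where "t = cls d"
  define f where "f = t \<otimes>\<^bsub>M\<^esub> s"
  have carr: "s \<in> carrier M" "t \<in> carrier M" "f \<in> carrier M"
    using d \<rho> by (auto simp: s_def t_def f_def intro: cls_in_carrier mult_closed)
  have st: "s \<otimes>\<^bsub>M\<^esub> t = \<one>\<^bsub>M\<^esub>"
  proof -
    have "cls (comp \<rho> d) = cls ?e"
    proof (intro cls_eqI comp_in_DM \<rho> d unit_in_DM)
      \<comment> \<open>The middle point is \<open>\<iota> y\<close>: the leg from \<open>x\<close>
        costs at most \<open>dX x y + C\<close>, the leg back to \<open>y\<close> at most
        \<open>C\<close>.\<close>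
      show "dominated (comp \<rho> d) ?e"
      proof (rule dominatedI_add)
        fix x y assume X: "x \<in> X" "y \<in> X"
        show "cross (comp \<rho> d) x y \<le> cross ?e x y + 2 * C"
          using comp_cross_le[OF \<rho> d X(1) maps[OF X(2)] X(2)] tri(1)[OF X maps[OF X(2)]]
            c_iota[OF X(2)] X maps by (simp add: cross_d cross_\<rho>)
      qed
      show "dominated ?e (comp \<rho> d)"
      proof (rule dominatedI_add)
        fix x y assume X: "x \<in> X" "y \<in> X"
        have "dX x y \<le> cross (comp \<rho> d) x y"
          by (rule comp_cross_geI[OF X]) (use X tri(3) in \<open>simp add: cross_d cross_\<rho>\<close>)
        then show "cross ?e x y \<le> cross (comp \<rho> d) x y + 1" using X by simp
      qed
    qed
    then show ?thesis by (simp add: s_def t_def mult_cls \<rho> d one_eq)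
  qed
  \<comment> \<open>A right inverse \<open>cls b\<close> must keep \<open>x\<close> at bounded
    distance from \<open>(\<iota> x)'\<close>. By the triangle inequality \<open>cross b x y\<close>
    and \<open>cross d x y\<close> then both differ from \<open>dX (\<iota> x) y\<close> by a
    bounded amount, hence from each other.\<close>
  have right_inverse_unique: "t' = t" if t': "t' \<in> carrier M" "s \<otimes>\<^bsub>M\<^esub> t' = \<one>\<^bsub>M\<^esub>" for t'
  proof -
    obtain b where b: "b \<in> DM" "t' = cls b" using t'(1) by (rule carrierE)
    have "cls (comp \<rho> b) = cls ?e"
      using t'(2) by (simp add: b s_def mult_cls \<rho> one_eq)
    then have "dominated (comp \<rho> b) ?e" using unit_in_DM by (rule cls_eqD)
    \<comment> \<open>Radius 1 captures the diagonal, where the unit metric has crossing distance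
      exactly 1.\<close>
    then obtain K where K: "\<And>x y. x \<in> X \<Longrightarrow> y \<in> X \<Longrightarrow> cross ?e x y \<le> 1 \<Longrightarrow> cross (comp \<rho> b) x y \<le> K"
      by (rule dominatedD) blast
    \<comment> \<open>A short loop from \<open>x\<close> through \<open>y'\<close> back to
      \<open>x\<close> makes both \<open>cross b x y\<close> and \<open>c x y\<close> less than
      \<open>K + 1\<close>; the latter places \<open>y\<close> within \<open>K + 1 + C\<close> of
      \<open>\<iota> x\<close>.\<close>
    have b_iota: "cross b x (\<iota> x) \<le> 2 * (K + 1) + C" if x: "x \<in> X" for x
    proof -
      have "cross (comp \<rho> b) x x < K + 1" using K[OF x x] x by simp
      then obtain y where y: "y \<in> X" "cross b x y + cross \<rho> y x < K + 1"
        using comp_cross_lessD[OF \<rho> b(1) x x] by blast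
      have "cross b x (\<iota> x) \<le> cross b x y + dX y (\<iota> x)"
        using cross_triangle(2)[OF b(1) x maps[OF x] y(1)] .
      moreover have "dX y (\<iota> x) \<le> c x y + c x (\<iota> x)"
        using tri(4)[OF x maps[OF x] y(1)] .
      moreover have "0 \<le> cross b x y" "0 \<le> cross \<rho> y x" by (simp_all add: DM_nonneg b \<rho>)
      ultimately show ?thesis
        using y c_iota[OF x] x by (simp add: cross_\<rho>)
    qed
    have "cls b = cls d"
    proof (intro cls_eqI b d)
      show "dominated b d"
      proof (rule dominatedI_add)
        fix x y assume X: "x \<in> X" "y \<in> X"
        show "cross b x y \<le> cross d x y + (2 * (K + 1) + 2 * C)"
          using cross_triangle(2)[OF b(1) X maps[OF X(1)]] b_iota[OF X(1)] c_iota[OF X(1)]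
            cross_triangle(4)[OF d X(1) maps[OF X(1)] X(2)] X maps by (simp add: cross_d)
      qed
      show "dominated d b"
      proof (rule dominatedI_add)
        fix x y assume X: "x \<in> X" "y \<in> X"
        show "cross d x y \<le> cross b x y + (2 * (K + 1) + 2 * C)"
          using cross_triangle(2)[OF d X maps[OF X(1)]] b_iota[OF X(1)] c_iota[OF X(1)]
            cross_triangle(4)[OF b(1) X(1) maps[OF X(1)] X(2)] X maps by (simp add: cross_d)
      qed
    qed
    then show ?thesis by (simp add: b t_def)
  qed
  have tst: "t \<otimes>\<^bsub>M\<^esub> s \<otimes>\<^bsub>M\<^esub> t = t"
    using carr unital(2) by (simp add: mult_assoc st)
  have pinv: "pseudo_inverse M s = t"
    unfolding pseudo_inverse_def
  proof (rule the_equality)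
    show "t \<in> carrier M \<and> s \<otimes>\<^bsub>M\<^esub> t \<otimes>\<^bsub>M\<^esub> s = s \<and> t \<otimes>\<^bsub>M\<^esub> s \<otimes>\<^bsub>M\<^esub> t = t"
      using carr unital(2) st tst by simp
    fix t' assume t': "t' \<in> carrier M \<and> s \<otimes>\<^bsub>M\<^esub> t' \<otimes>\<^bsub>M\<^esub> s = s \<and> t' \<otimes>\<^bsub>M\<^esub> s \<otimes>\<^bsub>M\<^esub> t' = t'"
    \<comment> \<open>Multiplying \<open>s t' s = s\<close> on the right by \<open>t\<close> turns
      the pseudo-inverse \<open>t'\<close> into a right inverse of \<open>s\<close>.\<close>
    have "s \<otimes>\<^bsub>M\<^esub> t' = s \<otimes>\<^bsub>M\<^esub> t' \<otimes>\<^bsub>M\<^esub> (s \<otimes>\<^bsub>M\<^esub> t)"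
      using t' carr unital(2)[OF mult_closed[OF carr(1)]] by (simp only: st)
    also have "\<dots> = s \<otimes>\<^bsub>M\<^esub> t' \<otimes>\<^bsub>M\<^esub> s \<otimes>\<^bsub>M\<^esub> t"
      using t' carr by (metis mult_assoc mult_closed)
    also have "\<dots> = \<one>\<^bsub>M\<^esub>" using t' st by simp
    finally show "t' = t" using right_inverse_unique t' by blast
  qed
  have "f \<noteq> \<one>\<^bsub>M\<^esub>"
  proof
    assume "f = \<one>\<^bsub>M\<^esub>"
    then have "cls (comp d \<rho>) = cls ?e"
      by (simp add: f_def s_def t_def mult_cls \<rho> d one_eq)
    then have "dominated (comp d \<rho>) ?e" using unit_in_DM by (rule cls_eqD)
    then obtain K where K: "\<And>x y. x \<in> X \<Longrightarrow> y \<in> X \<Longrightarrow> cross ?e x y \<le> 1 \<Longrightarrow> cross (comp d \<rho>) x y \<le> K"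
      by (rule dominatedD) blast
    \<comment> \<open>Every jump lands in the image of \<open>\<iota>\<close>, so a point
      \<open>z\<close> at distance at least \<open>K + 1\<close> from that image has
      \<open>c y z \<ge> K + 1\<close> for all \<open>y\<close>. This contradicts the bound
      \<open>K\<close> at the diagonal pair of \<open>z\<close>.\<close>
    obtain z where z: "z \<in> X" "\<And>x. x \<in> X \<Longrightarrow> K + 1 \<le> dX z (\<iota> x)" using far by blast
    have "cross (comp d \<rho>) z z < K + 1" using K[OF z(1) z(1)] z(1) by simp
    then obtain y where y: "y \<in> X" "cross \<rho> z y + cross d y z < K + 1"
      using comp_cross_lessD[OF d \<rho> z(1) z(1)] by blast
    have "K + 1 \<le> c y z"
    proof (rule c_ge)
      fix u assume u: "u \<in> X"
      show "K + 1 \<le> dX y u + C + dX (\<iota> u) z"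
        using z(2)[OF u] dX_sym[OF z(1) maps[OF u]] dX_nonneg[OF y(1) u] C(1) by linarith
    qed
    moreover have "0 \<le> cross \<rho> z y" by (simp add: DM_nonneg \<rho>)
    ultimately show False using y z(1) by (simp add: cross_d)
  qed
  moreover have "f \<in> idempotents M"
    using carr tst by (simp add: idempotents_def f_def flip: mult_assoc)
  moreover have "idem_le M f \<one>\<^bsub>M\<^esub>"
    using carr unital(2) by (simp add: idem_le_def)
  moreover have "idem_equiv M f \<one>\<^bsub>M\<^esub>"
    unfolding idem_equiv_def by (rule bexI[OF _ carr(1)]) (simp add: pinv f_def st)
  moreover have "\<one>\<^bsub>M\<^esub> \<in> idempotents M"
    using unital by (simp add: idempotents_def)
  ultimately show ?thesis unfolding infinite_idempotent_def by blast
qed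

end


section \<open>Word metrics\<close>

context group
begin

section \<open>Products of words in a group\<close>

lemma foldr_mult_closed: "set ws \<subseteq> carrier G \<Longrightarrow> foldr (\<otimes>) ws \<one> \<in> carrier G"
  by (induction ws) auto

lemma foldr_mult_append:
  "set us \<subseteq> carrier G \<Longrightarrow> set vs \<subseteq> carrier G \<Longrightarrow>
    foldr (\<otimes>) (us @ vs) \<one> = foldr (\<otimes>) us \<one> \<otimes> foldr (\<otimes>) vs \<one>"
  by (induction us) (auto simp: m_assoc foldr_mult_closed simp del: foldr_append)

lemma foldr_mult_inv:
  "set ws \<subseteq> carrier G \<Longrightarrow> foldr (\<otimes>) (rev (map (m_inv G) ws)) \<one> = inv (foldr (\<otimes>) ws \<one>)"
proof (induction ws)
  case (Cons a ws)
  have "foldr (\<otimes>) (rev (map (m_inv G) ws) @ [inv a]) \<one>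
      = foldr (\<otimes>) (rev (map (m_inv G) ws)) \<one> \<otimes> foldr (\<otimes>) [inv a] \<one>"
    using Cons.prems by (intro foldr_mult_append) auto
  then show ?case
    using Cons by (simp add: inv_mult_group foldr_mult_closed del: foldr_append)
qed simp

text \<open>Supplies the witness that makes the \<open>LEAST\<close> in \<open>word_length\<close>
  meaningful.\<close>

lemma ex_word:
  assumes S: "S \<subseteq> carrier G" and x: "x \<in> generate G S"
  shows "\<exists>ws. set ws \<subseteq> S \<union> m_inv G ` S \<and> foldr (\<otimes>) ws \<one> = x"
  using x
proof (induction rule: generate.induct)
  case one
  show ?case by (intro exI[of _ "[]"]) simp
next
  case (incl h)
  then show ?case using S by (intro exI[of _ "[h]"]) auto
next
  case (inv h)
  then show ?case using S by (intro exI[of _ "[inv h]"]) auto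
next
  case (eng h1 h2)
  then obtain us vs where "set us \<subseteq> S \<union> m_inv G ` S" "foldr (\<otimes>) us \<one> = h1"
    "set vs \<subseteq> S \<union> m_inv G ` S" "foldr (\<otimes>) vs \<one> = h2" by blast
  moreover have "S \<union> m_inv G ` S \<subseteq> carrier G" using S by auto
  ultimately show ?case
    using foldr_mult_append[of us vs] by (intro exI[of _ "us @ vs"]) (auto simp del: foldr_append)
qed

section \<open>Word length and the metric it defines\<close>

lemma word_length_le:
  "set ws \<subseteq> S \<union> m_inv G ` S \<Longrightarrow> word_length G S (foldr (\<otimes>) ws \<one>) \<le> length ws"
  unfolding word_length_def by (rule Least_le) blast

lemma word_length_word:
  assumes "S \<subseteq> carrier G" "x \<in> generate G S"
  obtains ws where "set ws \<subseteq> S \<union> m_inv G ` S" "foldr (\<otimes>) ws \<one> = x" "length ws = word_length G S x"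
proof -
  have "\<exists>ws. length ws = word_length G S x \<and> set ws \<subseteq> S \<union> m_inv G ` S \<and> foldr (\<otimes>) ws \<one> = x"
    unfolding word_length_def by (rule LeastI_ex) (use ex_word[OF assms] in blast)
  then show ?thesis using that by blast
qed

lemma word_length_eq_0_iff:
  assumes "S \<subseteq> carrier G" "x \<in> generate G S"
  shows "word_length G S x = 0 \<longleftrightarrow> x = \<one>"
proof
  show "x = \<one>" if "word_length G S x = 0"
    using word_length_word[OF assms] that by (metis foldr_Nil id_apply length_0_conv)
  show "word_length G S x = 0" if "x = \<one>"
    using word_length_le[of "[]" S] that by simp
qed

lemma word_length_mult_le:
  assumes S: "S \<subseteq> carrier G" and "x \<in> generate G S" "y \<in> generate G S"
  shows "word_length G S (x \<otimes> y) \<le> word_length G S x + word_length G S y"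
proof -
  obtain us where us: "set us \<subseteq> S \<union> m_inv G ` S" "foldr (\<otimes>) us \<one> = x" "length us = word_length G S x"
    using word_length_word assms by blast
  obtain vs where vs: "set vs \<subseteq> S \<union> m_inv G ` S" "foldr (\<otimes>) vs \<one> = y" "length vs = word_length G S y"
    using word_length_word assms by blast
  have "S \<union> m_inv G ` S \<subseteq> carrier G" using S by auto
  then have "foldr (\<otimes>) (us @ vs) \<one> = x \<otimes> y"
    using us vs foldr_mult_append[of us vs] by (metis subset_trans)
  then show ?thesis
    using word_length_le[of "us @ vs" S] us vs by (simp del: foldr_append)
qed

text \<open>Reversing a word and inverting its letters stays in the alphabet, which is closed under
  inversion.\<close>

lemma word_length_inv_le:
  assumes S: "S \<subseteq> carrier G" and "x \<in> generate G S"
  shows "word_length G S (inv x) \<le> word_length G S x"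
proof -
  obtain ws where ws: "set ws \<subseteq> S \<union> m_inv G ` S" "foldr (\<otimes>) ws \<one> = x" "length ws = word_length G S x"
    using word_length_word assms by blast
  have "S \<union> m_inv G ` S \<subseteq> carrier G" using S by auto
  then have "foldr (\<otimes>) (rev (map (m_inv G) ws)) \<one> = inv x"
    using ws foldr_mult_inv[of ws] by (metis subset_trans)
  moreover have "inv (inv a) = a" if "a \<in> S" for a using S that by auto
  then have "set (rev (map (m_inv G) ws)) \<subseteq> S \<union> m_inv G ` S"
    using ws(1) by fastforce
  ultimately show ?thesis
    using word_length_le[of "rev (map (m_inv G) ws)" S] ws(3) by simp
qed

lemma word_length_inv:
  assumes "S \<subseteq> carrier G" and "x \<in> generate G S"
  shows "word_length G S (inv x) = word_length G S x"
proof (rule antisym[OF word_length_inv_le[OF assms]])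
  have "x \<in> carrier G" using generate_in_carrier assms by blast
  then show "word_length G S x \<le> word_length G S (inv x)"
    using word_length_inv_le[OF assms(1) generate_m_inv_closed[OF assms]] by simp
qed

lemma metric_double_word_dist:
  assumes S: "S \<subseteq> carrier G" and gen: "generate G S = carrier G"
  shows "metric_double (carrier G) (word_dist G S)"
proof
  show "carrier G \<noteq> {}" by blast
  fix x y assume xy: "x \<in> carrier G" "y \<in> carrier G"
  show "0 \<le> word_dist G S x y" by (simp add: word_dist_def)
  have "inv x \<otimes> y = \<one> \<longleftrightarrow> x = y"
    using xy by (metis inv_closed inv_equality inv_inv l_inv)
  then show "word_dist G S x y = 0 \<longleftrightarrow> x = y"
    using xy by (simp add: word_dist_def word_length_eq_0_iff S gen)
  have "inv (inv x \<otimes> y) = inv y \<otimes> x" using xy by (simp add: inv_mult_group)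
  then show "word_dist G S x y = word_dist G S y x"
    using xy word_length_inv[OF S, of "inv x \<otimes> y"] by (simp add: word_dist_def gen)
  fix z assume z: "z \<in> carrier G"
  have "inv x \<otimes> y \<otimes> (inv y \<otimes> z) = inv x \<otimes> z"
    using xy z by (metis inv_closed inv_solve_left m_assoc m_closed)
  then show "word_dist G S x z \<le> word_dist G S x y + word_dist G S y z"
    using xy z word_length_mult_le[OF S, of "inv x \<otimes> y" "inv y \<otimes> z"]
    by (simp add: word_dist_def gen)
qed

lemma word_dist_left_invariant:
  assumes "g \<in> carrier G" "x \<in> carrier G" "y \<in> carrier G"
  shows "word_dist G S (g \<otimes> x) (g \<otimes> y) = word_dist G S x y"
proof -
  have "inv (g \<otimes> x) \<otimes> (g \<otimes> y) = inv x \<otimes> y"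
    using assms by (metis inv_closed inv_mult_group inv_solve_left m_assoc m_closed)
  then show ?thesis by (simp add: word_dist_def)
qed

end

theorem theorem3p2:
  fixes G :: "('a, 'b) monoid_scheme" and S :: "'a set"
  assumes "group G"
    and "finite S" and "S \<subseteq> carrier G" and "generate G S = carrier G"
    and "property_I G (word_dist G S)"
  shows "\<not> weakly_finite (double_semigroup (carrier G) (word_dist G S))"
proof
  assume wf: "weakly_finite (double_semigroup (carrier G) (word_dist G S))"
  interpret group G by fact
  let ?d = "word_dist G S"
  interpret metric_double "carrier G" ?d
    using assms(3,4) by (rule metric_double_word_dist)
  obtain Y Z g h C where YZ: "carrier G = Y \<union> Z" "Y \<inter> Z = {}"
    and far: "\<forall>D>0. \<exists>z\<in>Z. (INF y\<in>Y. ?d z y) > D"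
    and gh: "g \<in> carrier G" "h \<in> carrier G" "g <#\<^bsub>G\<^esub> Y \<subseteq> Y" "h <#\<^bsub>G\<^esub> Z \<subseteq> Y"
    and C: "0 < C" "\<forall>y\<in>Y. \<forall>z\<in>Z. \<bar>?d (g \<otimes>\<^bsub>G\<^esub> y) (h \<otimes>\<^bsub>G\<^esub> z) - ?d y z\<bar> < C"
    using assms(5) unfolding property_I_def by blast
  define \<iota> where "\<iota> x = (if x \<in> Y then g \<otimes>\<^bsub>G\<^esub> x else h \<otimes>\<^bsub>G\<^esub> x)" for x
  have \<iota>_Y: "\<iota> x \<in> Y" if "x \<in> carrier G" for x
    using that gh(3,4) YZ(1) by (auto simp: \<iota>_def l_coset_def)
  have "infinite_idempotent M \<one>\<^bsub>M\<^esub>"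
  proof (rule infinite_unit)
    show "\<one>\<^bsub>M\<^esub> \<in> carrier M"
      using wf by (simp add: weakly_finite_def)
    show "\<one>\<^bsub>M\<^esub> \<otimes>\<^bsub>M\<^esub> s = s \<and> s \<otimes>\<^bsub>M\<^esub> \<one>\<^bsub>M\<^esub> = s" if "s \<in> carrier M" for s
      using wf that unfolding weakly_finite_def by blast
    show "\<iota> x \<in> carrier G" if "x \<in> carrier G" for x
      using \<iota>_Y[OF that] YZ(1) by blast
    show "0 < C" by fact
    show "\<bar>?d (\<iota> x) (\<iota> y) - ?d x y\<bar> \<le> C" if xy: "x \<in> carrier G" "y \<in> carrier G" for x y
    \<comment> \<open>Within \<open>Y\<close> or within \<open>Z\<close> the map
      \<open>\<iota>\<close> is a left translation, hence isometric; only mixed pairs need the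
      constant from (i3).\<close>
    proof (cases "x \<in> Y \<longleftrightarrow> y \<in> Y")
      case True
      then show ?thesis
        using xy gh C(1) by (auto simp: \<iota>_def word_dist_left_invariant)
    next
      case False
      \<comment> \<open>(i3) takes the point of \<open>Y\<close> first; symmetry of the metric
        covers the other order.\<close>
      have swap: "?d (h \<otimes>\<^bsub>G\<^esub> x) (g \<otimes>\<^bsub>G\<^esub> y) = ?d (g \<otimes>\<^bsub>G\<^esub> y) (h \<otimes>\<^bsub>G\<^esub> x)" "?d x y = ?d y x"
        using dX_sym xy gh by simp_all
      show ?thesis
      proof (cases "x \<in> Y")
        case True
        then show ?thesis
          using False C(2) YZ xy by (force simp: \<iota>_def)
      next
        case x: False
        then have "x \<in> Z" "y \<in> Y" using False xy YZ by auto
        then show ?thesis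
          using C(2) x by (force simp: \<iota>_def swap)
      qed
    qed
    show "\<exists>z\<in>carrier G. \<forall>x\<in>carrier G. D \<le> ?d z (\<iota> x)" for D
    proof -
      \<comment> \<open>(i1) speaks only of positive radii, hence \<open>max D 1\<close>.\<close>
      obtain z where z: "z \<in> Z" "(INF y\<in>Y. ?d z y) > max D 1"
        using far by (metis less_max_iff_disj zero_less_one)
      have "bdd_below (?d z ` Y)"
        using z YZ dX_nonneg by (intro bdd_belowI2[of _ 0]) auto
      then have "(INF y\<in>Y. ?d z y) \<le> ?d z (\<iota> x)" if "x \<in> carrier G" for x
        using \<iota>_Y[OF that] by (rule cINF_lower)
      then show ?thesis using z YZ by (intro bexI[of _ z]) force+
    qed
  qed
  then show False
    using wf by (simp add: weakly_finite_def finite_idempotent_def)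
qed

end
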